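(* Let $\Omega\subset\mathbb{C}$ be a connected open set, $T\in\mathcal{B}_1(\Omega)$, $z_0\in\Omega$, and let $B$ be the canonical right inverse of $T-z_0$. Then the following statements are equivalent: (1) $\bigvee_{k=0}^\infty\ker (B^* )^k=\mathcal{H}$; (2) there exists a Markushevich basis $\{f_k\}_{k=0}^\infty$ of $\mathcal{H}$ satisfying $f_0\perp f_k$ for $k\ge 1$ such that $T-z_0$ is a backward shift on $\{f_k\}_{k=0}^\infty$; (3) there is a positive real number $\varepsilon$ such that $B^*\in\mathcal{B}_1(\mathbb{D}_\varepsilon)$, where $\mathbb{D}_\varepsilon=\{z\in\mathbb{C}:|z|<\varepsilon\}$.
   Context: $\mathcal{H}$ is a separable, infinite dimensional complex Hilbert space with inner product $(\cdot,\cdot)$, $\mathcal{L}(\mathcal{H})$ is the algebra of bounded linear operators on $\mathcal{H}$, and $\bigvee$ denotes closed linear span. For a connected open set $\Omega\subset\mathbb{C}$, $\mathcal{B}_1(\Omega)$ is the set of $T\in\mathcal{L}(\mathcal{H})$ such that: $\Omega\subset\sigma(T)$; $\mathrm{ran}(T-z)=\mathcal{H}$ for all $z\in\Omega$; $\bigvee_{z\in\Omega}\ker(T-z)=\mathcal{H}$; and $\dim\ker(T-z)=1$ for all $z\in\Omega$. If $A\in\mathcal{L}(\mathcal{H})$ is surjective, its canonical right inverse is the unique $B\in\mathcal{L}(\mathcal{H})$ with $AB=I$ and $\mathrm{ran}\,B=(\ker A)^\perp$. A sequence $\{f_k\}_{k=0}^\infty$ is a Markushevich basis of $\mathcal{H}$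 if $\bigvee_{k\ge 0}\{f_k\}=\mathcal{H}$ and there is a sequence $\{g_k\}_{k=0}^\infty$ in $\mathcal{H}$ with $(f_i,g_j)=\delta_{ij}$ for all $i,j\ge 0$ and $\{x\in\mathcal{H}:(x,g_k)=0\ \forall k\ge 0\}=\{0\}$. An operator $A$ is a backward shift on $\{f_k\}_{k=0}^\infty$ if $Af_0=0$ and $Af_k=f_{k-1}$ for $k\ge 1$. *)

theory Defs
  imports "HOL-Analysis.Analysis"
begin

section \<open>Complex Hilbert spaces\<close>

class complex_vector = real_vector +
  fixes scaleC :: "complex \<Rightarrow> 'a \<Rightarrow> 'a"  (infixr "*\<^sub>C" 75)
  assumes scaleC_add_right: "a *\<^sub>C (x + y) = a *\<^sub>C x + a *\<^sub>C y"
    and scaleC_add_left: "(a + b) *\<^sub>C x = a *\<^sub>C x + b *\<^sub>C x"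
    and scaleC_scaleC: "a *\<^sub>C b *\<^sub>C x = (a * b) *\<^sub>C x"
    and scaleC_one: "1 *\<^sub>C x = x"
    and scaleR_scaleC: "r *\<^sub>R x = complex_of_real r *\<^sub>C x"

global_interpretation complex_vector:
  vector_space "scaleC :: complex \<Rightarrow> 'a \<Rightarrow> 'a::complex_vector"
  by unfold_locales (simp_all add: scaleC_add_right scaleC_add_left scaleC_scaleC scaleC_one)

text \<open>
  The complex inner product is linear in the first argument. Its real part is the real inner
  product of \<^class>\<open>real_inner\<close>; since \<open>cinner x x\<close> is real by conjugate symmetry, positive
  definiteness and \<open>norm x = sqrt (Re (cinner x x))\<close> are inherited from that class, as is
  the norm topology.
\<close>

class complex_inner = complex_vector + real_inner +
  fixes cinner :: "'a \<Rightarrow> 'a \<Rightarrow> complex"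
  assumes cinner_commute: "cinner x y = cnj (cinner y x)"
    and cinner_add_left: "cinner (x + y) z = cinner x z + cinner y z"
    and cinner_scaleC_left: "cinner (c *\<^sub>C x) y = c * cinner x y"
    and inner_eq_Re_cinner: "inner x y = Re (cinner x y)"

class chilbert_space = complex_inner + banach

lemma cinner_self: "cinner x x = complex_of_real ((norm x)\<^sup>2)"
  for x :: "'a::complex_inner"
proof -
  have "Im (cinner x x) = 0"
    using cinner_commute[of x x] by (metis cnj.simps(2) equal_neg_zero)
  then show ?thesis
    by (simp add: complex_eq_iff power2_norm_eq_inner inner_eq_Re_cinner)
qed

lemma norm_scaleC: "norm (c *\<^sub>C x) = cmod c * norm x"
  for x :: "'a::complex_inner"
proof -
  have "cinner (c *\<^sub>C x) (c *\<^sub>C x) = c * (cnj c * cinner x x)"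
    by (metis cinner_commute cinner_scaleC_left complex_cnj_mult)
  then have "complex_of_real ((norm (c *\<^sub>C x))\<^sup>2) = complex_of_real ((cmod c * norm x)\<^sup>2)"
    by (simp only: cinner_self power_mult_distrib of_real_mult complex_norm_square mult.assoc)
  then have "(norm (c *\<^sub>C x))\<^sup>2 = (cmod c * norm x)\<^sup>2"
    using of_real_eq_iff by blast
  then show ?thesis
    by (simp add: power2_eq_iff_nonneg)
qed

definition infinite_dimensional :: "'a::complex_vector itself \<Rightarrow> bool" where
  "infinite_dimensional _ \<longleftrightarrow> \<not> (\<exists>S::'a set. finite S \<and> complex_vector.span S = UNIV)"

definition closed_cspan :: "'a::complex_inner set \<Rightarrow> 'a set" where
  "closed_cspan S = closure (complex_vector.span S)"

definition orth_compl :: "'a::complex_inner set \<Rightarrow> 'a set" where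
  "orth_compl S = {x. \<forall>y\<in>S. cinner x y = 0}"


section \<open>Bounded operators\<close>

definition bounded_clinear :: "('a::complex_inner \<Rightarrow> 'a) \<Rightarrow> bool" where
  "bounded_clinear A \<longleftrightarrow> bounded_linear A \<and> (\<forall>c x. A (c *\<^sub>C x) = c *\<^sub>C A x)"

definition op_minus :: "('a::complex_vector \<Rightarrow> 'a) \<Rightarrow> complex \<Rightarrow> 'a \<Rightarrow> 'a" where
  "op_minus A z = (\<lambda>x. A x - z *\<^sub>C x)"

definition ker :: "('a::complex_vector \<Rightarrow> 'a) \<Rightarrow> 'a set" where
  "ker A = {x. A x = 0}"

definition spectrum :: "('a::complex_inner \<Rightarrow> 'a) \<Rightarrow> complex set" where
  "spectrum A =
    {z. \<not> (\<exists>S. bounded_clinear S \<and> S \<circ> op_minus A z = id \<and> op_minus A z \<circ> S = id)}"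

text \<open>
  For bounded \<open>A\<close> on a Hilbert space the function described below exists (Riesz) and is unique,
  and it is automatically linear and bounded.
\<close>

definition cadjoint :: "('a::chilbert_space \<Rightarrow> 'a) \<Rightarrow> 'a \<Rightarrow> 'a" where
  "cadjoint A = (THE C. \<forall>x y. cinner (A x) y = cinner x (C y))"

definition canonical_right_inverse ::
    "('a::chilbert_space \<Rightarrow> 'a) \<Rightarrow> ('a \<Rightarrow> 'a) \<Rightarrow> bool" where
  "canonical_right_inverse A B \<longleftrightarrow>
    bounded_clinear B \<and> A \<circ> B = id \<and> range B = orth_compl (ker A)"

text \<open>
  The Cowen--Douglas class of rank one. Note that \<open>dim\<close> is also \<open>0\<close> for infinite-dimensional
  subspaces, which does not affect \<open>dim = 1\<close>. Openness and connectedness of \<open>\<Omega>\<close> are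
  left to the user of the definition.
\<close>

definition cowen_douglas_1 :: "complex set \<Rightarrow> ('a::chilbert_space \<Rightarrow> 'a) set" where
  "cowen_douglas_1 \<Omega> = {T. bounded_clinear T \<and>
     \<Omega> \<subseteq> spectrum T \<and>
     (\<forall>z\<in>\<Omega>. range (op_minus T z) = UNIV) \<and>
     closed_cspan (\<Union>z\<in>\<Omega>. ker (op_minus T z)) = UNIV \<and>
     (\<forall>z\<in>\<Omega>. complex_vector.dim (ker (op_minus T z)) = 1)}"


section \<open>Markushevich bases and backward shifts\<close>

definition markushevich_basis :: "(nat \<Rightarrow> 'a::chilbert_space) \<Rightarrow> bool" where
  "markushevich_basis f \<longleftrightarrow>
    closed_cspan (range f) = UNIV \<and>
    (\<exists>g. (\<forall>i j. cinner (f i) (g j) = (if i = j then 1 else 0)) \<and>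
         {x. \<forall>k. cinner x (g k) = 0} = {0})"

definition backward_shift_on ::
    "('a::chilbert_space \<Rightarrow> 'a) \<Rightarrow> (nat \<Rightarrow> 'a) \<Rightarrow> bool" where
  "backward_shift_on A f \<longleftrightarrow> A (f 0) = 0 \<and> (\<forall>k. A (f (Suc k)) = f k)"

end

theory Submission
  imports Defs "HOL-Complex_Analysis.Conformal_Mappings"
begin

text \<open>
  Let \<open>A = T - z0\<close> and let the unit vector \<open>e\<close> span \<open>ker A\<close>. Since \<open>AB = I\<close>, the sequences
  \<open>B\<^sup>k e\<close> and \<open>(A\<^sup>*)\<^sup>k e\<close> are biorthogonal, and a sequence as in (2) is a multiple of the
  first one. Near \<open>z0\<close> the kernel of \<open>T - z\<close> is spanned by \<open>\<Sum>k. (z - z0)\<^sup>k B\<^sup>k e\<close>, so a vector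
  orthogonal to all \<open>B\<^sup>k e\<close> is orthogonal to these kernels; by analytic continuation through
  the connected set \<open>\<Omega>\<close> it is orthogonal to all eigenvectors, hence zero. Thus \<open>B\<^sup>k e\<close> is always
  complete, and each of (1), (2), (3) says that \<open>(A\<^sup>*)\<^sup>k e\<close> is complete too: \<open>A\<^sup>*\<close> is a right
  inverse of \<open>B\<^sup>*\<close>, so these vectors with \<open>k < n\<close> span \<open>ker (B\<^sup>*)\<^sup>n\<close>, and the kernels of
  \<open>B\<^sup>* - w\<close> for small \<open>w\<close> are spanned by \<open>\<Sum>k. w\<^sup>k (A\<^sup>*)\<^sup>k e\<close>.
\<close>

section \<open>Open mapping and Riesz representation\<close>

text \<open>Quantitative open mapping theorem. By Baire category the closure of the image of some
  ball has an interior point; differences of points of that image solve \<open>A x = y\<close> up to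
  half the error, and summing the successive corrections removes the error.\<close>

lemma surj_bounded_preimage:
  fixes A :: "'a::banach \<Rightarrow> 'b::banach"
  assumes A: "bounded_linear A" and surj: "surj A"
  obtains C where "C > 0" "\<And>y. \<exists>x. A x = y \<and> norm x \<le> C * norm y"
proof -
  interpret A: bounded_linear A by fact
  define F where "F n = closure (A ` ball 0 (real n))" for n
  have "\<exists>n. interior (F n) \<noteq> {}"
  proof (rule ccontr)
    assume "\<not> ?thesis"
    then have "Met_TC.mtopology interior_of \<Union>(range F) = {}"
      by (intro Met_TC.metric_Baire_category_alt) (auto simp: F_def complete_UNIV)
    moreover have "\<Union>(range F) = UNIV"
    proof -
      have "y \<in> \<Union>(range F)" for y
      proof -
        obtain x where "y = A x" using surj by blast
        moreover obtain n where "norm x < real n" using reals_Archimedean2 by blast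
        ultimately have "y \<in> F n"
          unfolding F_def by (intro subsetD[OF closure_subset] imageI) auto
        then show ?thesis by blast
      qed
      then show ?thesis by blast
    qed
    ultimately show False by simp
  qed
  then obtain n y0 where "y0 \<in> interior (F n)" by blast
  then obtain \<delta> where \<delta>: "\<delta> > 0" "ball y0 \<delta> \<subseteq> F n"
    by (meson mem_interior)
  \<comment> \<open>Below, \<open>x\<close> is \<open>a - b\<close> divided by \<open>t\<close>,
    where \<open>norm (a - b)\<close> is at most \<open>2 * real n\<close> and \<open>t\<close> is
    \<open>\<delta> / (2 * norm y)\<close>; this produces the factor 4.\<close>
  define K where "K = 4 * real n / \<delta>"
  have K: "K \<ge> 0" using \<delta> by (simp add: K_def)
  have approx: "\<exists>x. norm x \<le> K * norm y \<and> norm (y - A x) \<le> norm y / 2" for y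
  proof (cases "y = 0")
    case True
    then show ?thesis by (intro exI[of _ 0]) simp
  next
    case False
    \<comment> \<open>Scaling moves \<open>y\<close> into the ball of radius \<delta>. Both
      \<open>y0 + t *\<^sub>R y\<close> and \<open>y0\<close> are then nearly attained by
      \<open>A\<close>, and their difference cancels the unknown centre \<open>y0\<close>.\<close>
    define t where "t = \<delta> / (2 * norm y)"
    have t: "t > 0" using False \<delta> by (simp add: t_def)
    have ty: "norm (t *\<^sub>R y) < \<delta>" using False \<delta> by (simp add: t_def)
    then have "y0 + t *\<^sub>R y \<in> F n" "y0 \<in> F n"
      using \<delta> by (auto simp: dist_norm subset_iff)
    moreover have \<eta>: "t * norm y / 4 > 0" using t False by simp
    ultimately obtain a b where a: "a \<in> ball 0 (real n)" "dist (A a) (y0 + t *\<^sub>R y) < t * norm y / 4"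
      and b: "b \<in> ball 0 (real n)" "dist (A b) y0 < t * norm y / 4"
      unfolding F_def closure_approachable image_iff by blast
    define x where "x = (1 / t) *\<^sub>R (a - b)"
    have "norm x = norm (a - b) / t" using t by (simp add: x_def)
    also have "\<dots> \<le> (2 * real n) / t"
      using a b t norm_triangle_ineq4[of a b] by (intro divide_right_mono) auto
    also have "\<dots> = K * norm y" using False \<delta> by (simp add: t_def K_def field_simps)
    finally have 1: "norm x \<le> K * norm y" .
    have "t *\<^sub>R (y - A x) = ((y0 + t *\<^sub>R y) - A a) + (A b - y0)"
      using t by (simp add: x_def A.scaleR A.diff algebra_simps)
    also have "norm \<dots> \<le> t * norm y / 4 + t * norm y / 4"
      using a b by (intro norm_triangle_le add_mono) (simp_all add: dist_norm norm_minus_commute)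
    finally have "t * norm (y - A x) \<le> t * (norm y / 2)" using t by simp
    then have "norm (y - A x) \<le> norm y / 2" using t by (simp only: mult_le_cancel_left_pos)
    with 1 show ?thesis by blast
  qed
  then obtain S where S: "\<And>y. norm (S y) \<le> K * norm y" "\<And>y. norm (y - A (S y)) \<le> norm y / 2"
    by metis
  \<comment> \<open>The geometric series contributes \<open>2 * K\<close>; the added 1 keeps the
    constant positive when \<open>K = 0\<close>.\<close>
  have "\<exists>x. A x = y \<and> norm x \<le> (2 * K + 1) * norm y" for y
  proof -
    \<comment> \<open>The residuals \<open>r k\<close> at least halve in norm at each step, so the
      corrections \<open>S (r k)\<close> are summable and their images telescope to
      \<open>y\<close>.\<close>
    define r where "r = rec_nat y (\<lambda>_ z. z - A (S z))"
    have r0: "r 0 = y" and rS: "r (Suc k) = r k - A (S (r k))" for k by (simp_all add: r_def)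
    have rb: "norm (r k) \<le> norm y * (1/2) ^ k" for k
    proof (induction k)
      case (Suc k)
      have "norm (r (Suc k)) \<le> norm (r k) / 2" unfolding rS by (rule S)
      then show ?case using Suc by simp
    qed (simp add: r0)
    have xb: "norm (S (r k)) \<le> K * norm y * (1/2) ^ k" for k
      using S(1)[of "r k"] mult_left_mono[OF rb[of k] K] by simp
    have geo: "(\<lambda>k. K * norm y * (1/2) ^ k) sums (K * norm y * 2)"
      using sums_mult[OF geometric_sums[of "1/2::real"], of "K * norm y"] by simp
    have sm: "summable (\<lambda>k. norm (S (r k)))"
      by (rule summable_comparison_test[OF _ sums_summable[OF geo]]) (use xb in auto)
    define x where "x = (\<Sum>k. S (r k))"
    have "norm x \<le> (\<Sum>k. norm (S (r k)))" unfolding x_def by (rule summable_norm[OF sm])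
    also have "\<dots> \<le> (\<Sum>k. K * norm y * (1/2) ^ k)" by (rule suminf_le[OF xb sm sums_summable[OF geo]])
    also have "\<dots> = 2 * K * norm y" using sums_unique[OF geo] by simp
    also have "\<dots> \<le> (2 * K + 1) * norm y" by (simp add: distrib_right)
    finally have bound: "norm x \<le> (2 * K + 1) * norm y" .
    have "(\<lambda>k. A (S (r k))) sums A x"
      unfolding x_def by (intro A.sums summable_sums summable_norm_cancel[OF sm])
    moreover have "(\<Sum>k<m. A (S (r k))) = y - r m" for m
      by (induction m) (simp_all add: r0 rS)
    moreover have "r \<longlonglongrightarrow> 0"
    proof (rule Lim_null_comparison)
      show "\<forall>\<^sub>F k in sequentially. norm (r k) \<le> norm y * (1/2) ^ k" using rb by simp
      show "(\<lambda>k. norm y * (1/2) ^ k) \<longlonglongrightarrow> 0"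
        by (intro tendsto_mult_right_zero LIMSEQ_realpow_zero) auto
    qed
    then have "(\<lambda>m. y - r m) \<longlonglongrightarrow> y - 0" by (intro tendsto_intros)
    ultimately have "A x = y" by (simp add: sums_def LIMSEQ_unique)
    with bound show ?thesis by blast
  qed
  moreover have "2 * K + 1 > 0" using K by simp
  ultimately show thesis using that by blast
qed

text \<open>A sequence in \<open>M\<close> minimizing the distance to \<open>x\<close> is Cauchy by
  the parallelogram law, and minimality of its limit along every line in \<open>M\<close> forces
  orthogonality.\<close>

lemma orthogonal_projection_exists:
  fixes M :: "'a::{real_inner,banach} set"
  assumes M: "subspace M" "closed M"
  obtains m where "m \<in> M" "\<And>v. v \<in> M \<Longrightarrow> inner (x - m) v = 0"
proof -
  define d where "d = (INF m\<in>M. (norm (x - m))\<^sup>2)"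
  have "M \<noteq> {}" using M subspace_0 by blast
  have bdd: "bdd_below ((\<lambda>m. (norm (x - m))\<^sup>2) ` M)" by (rule bdd_belowI2[of _ 0]) simp
  have d: "d \<le> (norm (x - m))\<^sup>2" if "m \<in> M" for m
    unfolding d_def by (rule cINF_lower[OF bdd that])
  have "\<exists>m\<in>M. (norm (x - m))\<^sup>2 < d + 1 / real (Suc k)" for k
    using cINF_less_iff[OF \<open>M \<noteq> {}\<close> bdd, of "d + 1 / real (Suc k)"] unfolding d_def by simp
  then obtain s where s: "\<And>k. s k \<in> M" "\<And>k. (norm (x - s k))\<^sup>2 < d + 1 / real (Suc k)"
    by metis
  have diff: "(norm (s i - s j))\<^sup>2 \<le> 2 / real (Suc i) + 2 / real (Suc j)" for i j
  proof -
    \<comment> \<open>The midpoint also lies in \<open>M\<close>, so its squared distance is at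
      least \<open>d\<close>; the parallelogram identity then controls
      \<open>s i - s j\<close>.\<close>
    have "(1/2) *\<^sub>R (s i + s j) \<in> M" using M s by (simp add: subspace_add subspace_mul)
    then have "d \<le> (norm (x - (1/2) *\<^sub>R (s i + s j)))\<^sup>2" by (rule d)
    moreover have "(norm (s i - s j))\<^sup>2 = 2 * (norm (x - s i))\<^sup>2 + 2 * (norm (x - s j))\<^sup>2
        - 4 * (norm (x - (1/2) *\<^sub>R (s i + s j)))\<^sup>2"
      by (simp add: power2_norm_eq_inner inner_simps inner_commute field_simps)
    ultimately show ?thesis using s(2)[of i] s(2)[of j] by simp
  qed
  have "Cauchy s"
  proof (rule metric_CauchyI)
    fix e :: real assume "e > 0"
    then obtain N where N: "4 / e\<^sup>2 < real N" using reals_Archimedean2 by blast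
    have "dist (s i) (s j) < e" if "i \<ge> N" "j \<ge> N" for i j
    proof -
      have "2 / real (Suc i) \<le> 2 / real (Suc N)" "2 / real (Suc j) \<le> 2 / real (Suc N)"
        using that by (auto intro!: divide_left_mono)
      then have "(norm (s i - s j))\<^sup>2 \<le> 4 / real (Suc N)" using diff[of i j] by simp
      also have "4 / real (Suc N) < e\<^sup>2"
        using N \<open>e > 0\<close> by (simp add: field_simps add_strict_increasing)
      finally show ?thesis using \<open>e > 0\<close> by (simp add: dist_norm power2_less_imp_less)
    qed
    then show "\<exists>N. \<forall>i\<ge>N. \<forall>j\<ge>N. dist (s i) (s j) < e" by blast
  qed
  then obtain m where m: "s \<longlonglongrightarrow> m" using Cauchy_convergent convergent_def by blast
  have mM: "m \<in> M" using closed_sequentially[OF M(2) s(1) m] .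
  have "(norm (x - m))\<^sup>2 \<le> d + 0"
  proof (rule LIMSEQ_le)
    show "(\<lambda>k. (norm (x - s k))\<^sup>2) \<longlonglongrightarrow> (norm (x - m))\<^sup>2" using m by (intro tendsto_intros)
    show "(\<lambda>k. d + 1 / real (Suc k)) \<longlonglongrightarrow> d + 0"
      using LIMSEQ_inverse_real_of_nat by (intro tendsto_intros) (simp add: inverse_eq_divide)
    show "\<exists>N. \<forall>k\<ge>N. (norm (x - s k))\<^sup>2 \<le> d + 1 / real (Suc k)" using s(2) less_imp_le by blast
  qed
  have "inner (x - m) v = 0" if "v \<in> M" for v
  proof (cases "v = 0")
    case False
    \<comment> \<open>This \<open>t\<close> minimizes the distance from \<open>x\<close> to
      \<open>m + t *\<^sub>R v\<close>; any nonzero inner product would make it strictly smaller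
      than the minimum.\<close>
    define t where "t = inner (x - m) v / (norm v)\<^sup>2"
    have "m + t *\<^sub>R v \<in> M" using M mM that by (simp add: subspace_add subspace_mul)
    then have "(norm (x - m))\<^sup>2 \<le> (norm ((x - m) - t *\<^sub>R v))\<^sup>2"
      using d[of "m + t *\<^sub>R v"] \<open>(norm (x - m))\<^sup>2 \<le> d + 0\<close>
      unfolding diff_diff_eq by linarith
    also have "\<dots> = (norm (x - m))\<^sup>2 - 2 * t * inner (x - m) v + t\<^sup>2 * (norm v)\<^sup>2"
      unfolding power2_norm_eq_inner
      by (simp add: inner_simps inner_commute power2_eq_square algebra_simps)
    also have "\<dots> = (norm (x - m))\<^sup>2 - (inner (x - m) v)\<^sup>2 / (norm v)\<^sup>2"
      using False by (simp add: t_def power2_eq_square)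
    finally show ?thesis using False by (simp add: divide_le_0_iff)
  qed simp
  with mM show thesis using that by blast
qed

text \<open>The part \<open>z\<close> of a vector outside the kernel that is orthogonal to the
  kernel represents the functional up to scale, because
  \<open>\<phi> z *\<^sub>R x - \<phi> x *\<^sub>R z\<close> always lies in the kernel.\<close>

lemma riesz_representation_real:
  fixes \<phi> :: "'a::{real_inner,banach} \<Rightarrow> real"
  assumes "bounded_linear \<phi>"
  obtains u where "\<And>x. \<phi> x = inner x u"
proof (cases "\<forall>x. \<phi> x = 0")
  case True
  then show thesis using that[of 0] by simp
next
  case False
  interpret \<phi>: bounded_linear \<phi> by fact
  from False obtain a where a: "\<phi> a \<noteq> 0" by blast
  have "subspace {x. \<phi> x = 0}"
    by (simp add: subspace_def \<phi>.add \<phi>.scaleR)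
  moreover have "closed {x. \<phi> x = 0}"
    by (intro closed_Collect_eq continuous_intros \<phi>.continuous_on)
  ultimately obtain m where m: "\<phi> m = 0" "\<And>v. \<phi> v = 0 \<Longrightarrow> inner (a - m) v = 0"
    using orthogonal_projection_exists[of "{x. \<phi> x = 0}" a] by auto
  define z where "z = a - m"
  have z: "\<phi> z = \<phi> a" by (simp add: z_def \<phi>.diff m)
  then have "z \<noteq> 0" using a \<phi>.zero by metis
  have "\<phi> x = inner x ((\<phi> z / inner z z) *\<^sub>R z)" for x
  proof -
    have "inner z (\<phi> z *\<^sub>R x - \<phi> x *\<^sub>R z) = 0"
      unfolding z_def by (rule m(2)) (simp add: \<phi>.diff \<phi>.scaleR)
    then show ?thesis using \<open>z \<noteq> 0\<close> by (simp add: inner_simps inner_commute field_simps)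
  qed
  then show thesis by (rule that)
qed

text \<open>Riesz representation yields the value at each \<open>y\<close>. Linearity follows from
  uniqueness of representing vectors, and boundedness from testing the identity at
  \<open>x = C y\<close>.\<close>

lemma real_adjoint_exists:
  fixes A :: "'a::{real_inner,banach} \<Rightarrow> 'a"
  assumes A: "bounded_linear A"
  obtains C where "bounded_linear C" "\<And>x y. inner (A x) y = inner x (C y)"
proof -
  interpret A: bounded_linear A by fact
  have "\<exists>u. \<forall>x. inner (A x) y = inner x u" for y
    using riesz_representation_real[OF bounded_linear_compose[OF bounded_linear_inner_left A], of y]
    by metis
  then obtain C where C: "\<And>x y. inner (A x) y = inner x (C y)" by metis
  have eqI: "u = v" if "\<And>x. inner x u = inner x v" for u v :: 'a
    using that[of "u - v"] by (metis inner_diff_right inner_eq_zero_iff right_minus_eq)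
  obtain K where K: "K > 0" "\<And>x. norm (A x) \<le> norm x * K" using A.pos_bounded by blast
  have "bounded_linear C"
  proof (rule bounded_linear_intro)
    show "C (x + y) = C x + C y" for x y
      by (rule eqI) (simp add: inner_simps flip: C)
    show "C (r *\<^sub>R x) = r *\<^sub>R C x" for r x
      by (rule eqI) (simp add: inner_simps flip: C)
    show "norm (C y) \<le> norm y * K" for y
    proof (cases "C y = 0")
      case False
      have "norm (C y) * norm (C y) = inner (A (C y)) y"
        by (simp add: C power2_norm_eq_inner flip: power2_eq_square)
      also have "\<dots> \<le> norm (A (C y)) * norm y" by (rule norm_cauchy_schwarz)
      also have "\<dots> \<le> norm (C y) * K * norm y" by (intro mult_right_mono K) simp
      finally have "norm (C y) * norm (C y) \<le> norm (C y) * (norm y * K)" by (simp add: ac_simps)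
      then show ?thesis using False by simp
    qed (use K in simp)
  qed
  with C show thesis using that by blast
qed

section \<open>Complex inner products and adjoints\<close>

lemma cinner_add_right: "cinner z (x + y) = cinner z x + cinner z y"
  for x :: "'a::complex_inner"
  by (metis cinner_commute cinner_add_left complex_cnj_add)

lemma cinner_scaleC_right: "cinner x (c *\<^sub>C y) = cnj c * cinner x y"
  for x :: "'a::complex_inner"
  by (metis cinner_commute cinner_scaleC_left complex_cnj_mult)

lemma cinner_zero_left [simp]: "cinner 0 y = 0"
  for y :: "'a::complex_inner"
  using cinner_add_left[of 0 0 y] by simp

lemma cinner_zero_right [simp]: "cinner x 0 = 0"
  for x :: "'a::complex_inner"
  using cinner_add_right[of x 0 0] by simp

lemma cinner_minus_left [simp]: "cinner (- x) y = - cinner x y"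
  for x :: "'a::complex_inner"
  using cinner_add_left[of "- x" x y] by (simp add: eq_neg_iff_add_eq_0)

lemma cinner_diff_left: "cinner (x - y) z = cinner x z - cinner y z"
  for x :: "'a::complex_inner"
  using cinner_add_left[of "x - y" y z] by simp

lemma cinner_diff_right: "cinner z (x - y) = cinner z x - cinner z y"
  for x :: "'a::complex_inner"
  using cinner_add_right[of z "x - y" y] by simp

lemma cinner_eq_0_commute: "cinner x y = 0 \<longleftrightarrow> cinner y x = 0"
  for x :: "'a::complex_inner"
  by (metis cinner_commute complex_cnj_zero)

lemma cinner_self_eq_0_iff [simp]: "cinner x x = 0 \<longleftrightarrow> x = 0"
  for x :: "'a::complex_inner"
  by (simp add: cinner_self)

lemma cinner_eqI: "u = v" if "\<And>x. cinner x u = cinner x v"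
  for u v :: "'a::complex_inner"
  using that[of "u - v"] by (metis cinner_diff_right cinner_self_eq_0_iff right_minus_eq)

text \<open>Multiplying \<open>x\<close> by a scalar of modulus at most 1 makes the inner product
  real and nonnegative, which reduces the claim to the real Cauchy-Schwarz inequality.\<close>

lemma cmod_cinner_le: "cmod (cinner x y) \<le> norm x * norm y"
  for x :: "'a::complex_inner"
proof -
  define c where "c = cnj (sgn (cinner x y))"
  have c: "c * cinner x y = of_real (cmod (cinner x y))"
    using complex_norm_square[of "cinner x y"]
    by (cases "cinner x y = 0") (simp_all add: c_def sgn_eq field_simps power2_eq_square)
  have "cmod (cinner x y) = inner (c *\<^sub>C x) y"
    by (simp add: inner_eq_Re_cinner cinner_scaleC_left c)
  also have "\<dots> \<le> norm (c *\<^sub>C x) * norm y" by (rule norm_cauchy_schwarz)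
  also have "\<dots> \<le> norm x * norm y"
    by (intro mult_right_mono) (auto simp: norm_scaleC c_def norm_sgn)
  finally show ?thesis .
qed

lemma bounded_linear_cinner_left: "bounded_linear (\<lambda>x. cinner x y)"
  for y :: "'a::complex_inner"
  by (rule bounded_linear_intro[of _ "norm y"])
    (simp_all add: cinner_add_left cinner_scaleC_left scaleR_scaleC scaleR_conv_of_real
      cmod_cinner_le)

lemma bounded_linear_scaleC_right: "bounded_linear (\<lambda>x::'a::complex_inner. c *\<^sub>C x)"
  by (rule bounded_linear_intro[of _ "cmod c"])
    (simp_all add: scaleC_add_right scaleC_scaleC norm_scaleC scaleR_scaleC mult.commute)

section \<open>Closed complex spans and their annihilators\<close>

lemma subspace_closure:
  fixes V :: "'a::real_normed_vector set"
  assumes V: "subspace V"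
  shows "subspace (closure V)"
  unfolding subspace_def
proof (intro conjI ballI allI)
  show "0 \<in> closure V" using V closure_subset subspace_0 by blast
  show "x + y \<in> closure V" if "x \<in> closure V" "y \<in> closure V" for x y
  proof -
    obtain s t where "\<forall>n. s n \<in> V" "s \<longlonglongrightarrow> x" "\<forall>n. t n \<in> V" "t \<longlonglongrightarrow> y"
      using \<open>x \<in> closure V\<close> \<open>y \<in> closure V\<close> unfolding closure_sequential by blast
    then have "\<forall>n. s n + t n \<in> V" "(\<lambda>n. s n + t n) \<longlonglongrightarrow> x + y"
      using V by (auto intro: subspace_add tendsto_add)
    then show ?thesis
      unfolding closure_sequential by (intro exI[of _ "\<lambda>n. s n + t n"]) simp
  qed
  show "c *\<^sub>R x \<in> closure V" if "x \<in> closure V" for c x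
  proof -
    obtain s where "\<forall>n. s n \<in> V" "s \<longlonglongrightarrow> x"
      using \<open>x \<in> closure V\<close> unfolding closure_sequential by blast
    then have "\<forall>n. c *\<^sub>R s n \<in> V" "(\<lambda>n. c *\<^sub>R s n) \<longlonglongrightarrow> c *\<^sub>R x"
      using V by (auto intro: subspace_mul tendsto_intros)
    then show ?thesis
      unfolding closure_sequential by (intro exI[of _ "\<lambda>n. c *\<^sub>R s n"]) simp
  qed
qed

lemma real_subspaceI: "complex_vector.subspace V \<Longrightarrow> subspace V"
  for V :: "'a::complex_vector set"
  by (simp add: subspace_def complex_vector.subspace_def scaleR_scaleC)

text \<open>The vectors annihilated by \<open>y\<close> form a closed subspace; conversely, the
  residual of the projection onto the closed span annihilates \<open>S\<close>. All later density
  claims go through this criterion.\<close>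

lemma closed_cspan_eq_UNIV_iff:
  fixes S :: "'a::chilbert_space set"
  shows "closed_cspan S = UNIV \<longleftrightarrow> (\<forall>y. (\<forall>x\<in>S. cinner x y = 0) \<longrightarrow> y = 0)"
proof (intro iffI allI impI)
  fix y :: 'a
  assume S: "closed_cspan S = UNIV" and y: "\<forall>x\<in>S. cinner x y = 0"
  define M where "M = {x. cinner x y = 0}"
  have "complex_vector.subspace M"
    by (simp add: M_def complex_vector.subspace_def cinner_add_left cinner_scaleC_left)
  then have "complex_vector.span S \<subseteq> M"
    using y by (intro complex_vector.span_minimal) (auto simp: M_def)
  moreover have "closed M"
    unfolding M_def
    by (intro closed_Collect_eq continuous_intros
        bounded_linear.continuous_on[OF bounded_linear_cinner_left])
  ultimately have "closed_cspan S \<subseteq> M"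
    unfolding closed_cspan_def by (rule closure_minimal)
  then have "y \<in> M" using S by blast
  then show "y = 0" by (simp add: M_def)
next
  assume S: "\<forall>y. (\<forall>x\<in>S. cinner x y = 0) \<longrightarrow> y = 0"
  let ?M = "closed_cspan S"
  have "subspace ?M" "closed ?M"
    unfolding closed_cspan_def
    by (simp_all add: real_subspaceI subspace_closure complex_vector.subspace_span)
  have "x \<in> ?M" for x
  proof -
    obtain m where m: "m \<in> ?M" "\<And>v. v \<in> ?M \<Longrightarrow> inner (x - m) v = 0"
      using orthogonal_projection_exists[OF \<open>subspace ?M\<close> \<open>closed ?M\<close>] by blast
    have "cinner v (x - m) = 0" if "v \<in> S" for v
    proof -
      have "c *\<^sub>C v \<in> ?M" for c
        unfolding closed_cspan_def
        by (intro subsetD[OF closure_subset] complex_vector.span_scale complex_vector.span_base that)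
      then have *: "inner (c *\<^sub>C v) (x - m) = 0" for c
        using m(2) by (simp add: inner_commute)
      \<comment> \<open>The projection only gives real orthogonality; the multiples by 1 and by
        \<open>-\<i>\<close> recover the real and imaginary parts of the complex inner
        product.\<close>
      show ?thesis
        using *[of 1] *[of "-\<i>"]
        by (simp add: inner_eq_Re_cinner cinner_scaleC_left complex_eq_iff)
    qed
    then have "x - m = 0" using S by blast
    with m show ?thesis by simp
  qed
  then show "closed_cspan S = UNIV" by blast
qed

section \<open>Bounded complex-linear operators, adjoints and eigenspaces\<close>

lemma bounded_clinear_imp_linear: "bounded_clinear A \<Longrightarrow> bounded_linear A"
  by (simp add: bounded_clinear_def)

lemma bounded_clinear_scaleC: "bounded_clinear A \<Longrightarrow> A (c *\<^sub>C x) = c *\<^sub>C A x"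
  by (simp add: bounded_clinear_def)

lemma bounded_clinear_add: "bounded_clinear A \<Longrightarrow> A (x + y) = A x + A y"
  by (simp add: bounded_clinear_def linear_simps)

lemma bounded_clinear_diff: "bounded_clinear A \<Longrightarrow> A (x - y) = A x - A y"
  by (simp add: bounded_clinear_def linear_simps)

lemma bounded_clinear_zero: "bounded_clinear A \<Longrightarrow> A 0 = 0"
  by (simp add: bounded_clinear_def linear_simps)

text \<open>The real adjoint is already the complex one, since \<open>A\<close> commutes with
  multiplication by \<i>. Uniqueness then identifies it with the definite description in
  \<open>cadjoint\<close>.\<close>

lemma cadjoint:
  fixes A :: "'a::chilbert_space \<Rightarrow> 'a"
  assumes A: "bounded_clinear A"
  shows bounded_clinear_cadjoint: "bounded_clinear (cadjoint A)"
    and cinner_cadjoint: "cinner (A x) y = cinner x (cadjoint A y)"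
proof -
  obtain C where C: "bounded_linear C" "\<And>x y. inner (A x) y = inner x (C y)"
    using real_adjoint_exists[OF bounded_clinear_imp_linear[OF A]] by blast
  have adj: "cinner (A x) y = cinner x (C y)" for x y
    using C(2)[of x y] C(2)[of "(-\<i>) *\<^sub>C x" y]
    by (simp add: inner_eq_Re_cinner bounded_clinear_scaleC[OF A] cinner_scaleC_left complex_eq_iff
        del: complex_vector.scale_minus_left)
  have "cadjoint A = C"
    unfolding cadjoint_def
  proof (rule the_equality)
    show "\<forall>x y. cinner (A x) y = cinner x (C y)" using adj by blast
    show "D = C" if "\<forall>x y. cinner (A x) y = cinner x (D y)" for D
      using that adj by (intro ext cinner_eqI) simp
  qed
  moreover have "C (c *\<^sub>C x) = c *\<^sub>C C x" for c x
    by (rule cinner_eqI) (simp add: cinner_scaleC_right flip: adj)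
  ultimately show "bounded_clinear (cadjoint A)" "cinner (A x) y = cinner x (cadjoint A y)"
    using C adj by (simp_all add: bounded_clinear_def)
qed

lemma bounded_clinear_op_minus: "bounded_clinear A \<Longrightarrow> bounded_clinear (op_minus A z)"
  unfolding bounded_clinear_def op_minus_def
  by (auto intro!: bounded_linear_sub bounded_linear_scaleC_right
      simp: complex_vector.scale_right_diff_distrib scaleC_scaleC mult.commute)

lemma op_minus_op_minus: "op_minus (op_minus A z) w = op_minus A (z + w)"
  by (simp add: op_minus_def fun_eq_iff scaleC_add_left)

lemma op_minus_0 [simp]: "op_minus A 0 = A"
  by (simp add: op_minus_def)

lemma in_ker_op_minus_iff: "x \<in> ker (op_minus A z) \<longleftrightarrow> A x = z *\<^sub>C x"
  by (simp add: ker_def op_minus_def)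

lemma subspace_ker: "bounded_clinear A \<Longrightarrow> complex_vector.subspace (ker A)"
  by (simp add: ker_def complex_vector.subspace_def bounded_clinear_add bounded_clinear_scaleC
      bounded_clinear_zero)

lemma in_spectrum_if_eigenvector:
  assumes "A x = z *\<^sub>C x" "x \<noteq> 0"
  shows "z \<in> spectrum A"
proof -
  have "x = 0" if "bounded_clinear S" "S \<circ> op_minus A z = id" for S
  proof -
    have "x = S (op_minus A z x)" using that(2) by (simp add: fun_eq_iff)
    also have "\<dots> = 0" using assms(1) bounded_clinear_zero[OF that(1)] by (simp add: op_minus_def)
    finally show ?thesis .
  qed
  with assms(2) show ?thesis unfolding spectrum_def by blast
qed

lemma dim_range_scaleC: "e \<noteq> 0 \<Longrightarrow> complex_vector.dim (range (\<lambda>c. c *\<^sub>C e)) = 1"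
  using complex_vector.dim_span_eq_card_independent[of "{e}"]
  by (simp add: complex_vector.span_singleton)

lemma dim_1_eq_range_scaleC:
  assumes V: "complex_vector.subspace V" "complex_vector.dim V = 1" and "x \<in> V" "x \<noteq> 0"
  shows "V = range (\<lambda>c. c *\<^sub>C x)"
proof -
  obtain Bs where B: "Bs \<subseteq> V" "V \<subseteq> complex_vector.span Bs" "card Bs = 1"
    using complex_vector.basis_exists[of V] V by metis
  then obtain b where b: "Bs = {b}" by (auto simp: card_1_singleton_iff)
  then have Vb: "V \<subseteq> range (\<lambda>c. c *\<^sub>C b)" using B by (simp add: complex_vector.span_singleton)
  then obtain c where c: "x = c *\<^sub>C b" using assms by blast
  then have "c \<noteq> 0" using \<open>x \<noteq> 0\<close> by auto
  then have "b = (1 / c) *\<^sub>C x" by (simp add: c scaleC_scaleC scaleC_one)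
  then have "V \<subseteq> range (\<lambda>c. c *\<^sub>C x)" using Vb by (auto simp: scaleC_scaleC)
  moreover have "range (\<lambda>c. c *\<^sub>C x) \<subseteq> V"
    using assms by (auto intro: complex_vector.subspace_scale)
  ultimately show ?thesis by blast
qed

lemma dim_1_obtains_nonzero:
  assumes "complex_vector.dim V = 1"
  obtains e where "e \<in> V" "e \<noteq> 0"
proof -
  obtain Bs where B: "Bs \<subseteq> V" "complex_vector.independent Bs" "card Bs = 1"
    using complex_vector.basis_exists[of V] assms by metis
  then obtain b where "Bs = {b}" by (auto simp: card_1_singleton_iff)
  then show thesis using B that[of b] complex_vector.dependent_zero[of Bs] by auto
qed

lemma norm_funpow_le:
  fixes A :: "'a::real_normed_vector \<Rightarrow> 'a"
  assumes "C \<ge> 0" "\<And>x. norm (A x) \<le> C * norm x"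
  shows "norm ((A ^^ k) x) \<le> norm x * C ^ k"
proof (induction k)
  case (Suc k)
  have "norm ((A ^^ Suc k) x) \<le> C * norm ((A ^^ k) x)" using assms by simp
  also have "\<dots> \<le> C * (norm x * C ^ k)" by (rule mult_left_mono[OF Suc]) fact
  finally show ?case by (simp add: ac_simps)
qed simp

section \<open>Power series of eigenvectors\<close>

text \<open>The generating series of a chain: if an operator sends \<open>v (Suc k)\<close> to
  \<open>v k\<close> and kills \<open>v 0\<close>, the sum is in its kernel after subtracting
  \<open>w\<close>. Growth of at most \<open>D * C ^ k\<close> ensures convergence for
  \<open>cmod w < 1 / C\<close>.\<close>

definition chain_sum :: "(nat \<Rightarrow> 'a::chilbert_space) \<Rightarrow> complex \<Rightarrow> 'a" where
  "chain_sum v w = (\<Sum>k. w ^ k *\<^sub>C v k)"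

lemma chain_sum_sums:
  fixes v :: "nat \<Rightarrow> 'a::chilbert_space"
  assumes "\<And>k. norm (v k) \<le> D * C ^ k" "C > 0" "cmod w < 1 / C"
  shows "(\<lambda>k. w ^ k *\<^sub>C v k) sums chain_sum v w"
proof -
  have "norm (cmod w * C) < 1" using assms by (simp add: field_simps abs_mult)
  then have "summable (\<lambda>k. D * (cmod w * C) ^ k)"
    by (intro summable_mult summable_geometric)
  moreover have "norm (w ^ k *\<^sub>C v k) \<le> D * (cmod w * C) ^ k" for k
    using mult_left_mono[OF assms(1)[of k], of "cmod w ^ k"]
    by (simp add: norm_scaleC norm_power power_mult_distrib ac_simps)
  ultimately have "summable (\<lambda>k. w ^ k *\<^sub>C v k)"
    by (rule summable_comparison_test'[where N = 0])
  then show ?thesis unfolding chain_sum_def by (rule summable_sums)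
qed

lemma cinner_chain_sum_sums:
  fixes v :: "nat \<Rightarrow> 'a::chilbert_space"
  assumes "\<And>k. norm (v k) \<le> D * C ^ k" "C > 0" "cmod w < 1 / C"
  shows "(\<lambda>k. cinner (v k) y * w ^ k) sums cinner (chain_sum v w) y"
  using bounded_linear.sums[OF bounded_linear_cinner_left chain_sum_sums[OF assms]]
  by (simp add: cinner_scaleC_left mult.commute)

text \<open>Shifting the index reproduces the series times \<open>w\<close>. The term
  \<open>A (v 0)\<close> is kept so that the same formula yields eigenvectors when it vanishes and
  preimages under \<open>A - w\<close> when it does not.\<close>

lemma apply_chain_sum:
  fixes v :: "nat \<Rightarrow> 'a::chilbert_space"
  assumes A: "bounded_clinear A" "\<And>k. A (v (Suc k)) = v k"
    and v: "\<And>k. norm (v k) \<le> D * C ^ k" "C > 0" "cmod w < 1 / C"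
  shows "A (chain_sum v w) = A (v 0) + w *\<^sub>C chain_sum v w"
proof -
  note s = chain_sum_sums[OF v]
  have "(\<lambda>k. A (w ^ k *\<^sub>C v k)) sums A (chain_sum v w)"
    by (rule bounded_linear.sums[OF bounded_clinear_imp_linear[OF A(1)] s])
  then have "(\<lambda>k. A (w ^ Suc k *\<^sub>C v (Suc k))) sums (A (chain_sum v w) - A (v 0))"
    using sums_Suc_iff[of "\<lambda>k. A (w ^ k *\<^sub>C v k)" "A (chain_sum v w) - A (v 0)"]
    by (simp add: scaleC_one)
  moreover have "(\<lambda>k. A (w ^ Suc k *\<^sub>C v (Suc k))) = (\<lambda>k. w *\<^sub>C (w ^ k *\<^sub>C v k))"
    using A by (simp add: bounded_clinear_scaleC scaleC_scaleC)
  moreover have "(\<lambda>k. w *\<^sub>C (w ^ k *\<^sub>C v k)) sums (w *\<^sub>C chain_sum v w)"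
    by (rule bounded_linear.sums[OF bounded_linear_scaleC_right s])
  ultimately have "A (chain_sum v w) - A (v 0) = w *\<^sub>C chain_sum v w"
    by (metis sums_unique2)
  then show ?thesis by (simp add: algebra_simps)
qed

text \<open>Pairing with \<open>v 0\<close> gives a scalar power series whose constant term is the
  nonzero square of the norm of \<open>v 0\<close>, so it has no zeros near 0.\<close>

lemma chain_sum_nonzero:
  fixes v :: "nat \<Rightarrow> 'a::chilbert_space"
  assumes v: "\<And>k. norm (v k) \<le> D * C ^ k" "C > 0" and v0: "v 0 \<noteq> 0"
  obtains r where "r > 0" "r \<le> 1 / C" "\<And>w. cmod w < r \<Longrightarrow> chain_sum v w \<noteq> 0"
proof -
  define h where "h w = cinner (chain_sum v w) (v 0)" for w
  have h: "(\<lambda>k. cinner (v k) (v 0) * w ^ k) sums h w" if "cmod w < 1 / C" for w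
    unfolding h_def by (rule cinner_chain_sum_sums[OF v that])
  have h0: "h 0 = cinner (v 0) (v 0)" using h[of 0] v by simp
  have "(h \<longlongrightarrow> cinner (v 0) (v 0)) (at 0)"
    by (rule powser_limit_0[OF _ h]) (use v in simp_all)
  then have "\<forall>\<^sub>F w in at 0. h w \<noteq> 0"
    by (rule tendsto_imp_eventually_ne) (use v0 in simp)
  then obtain d where d: "d > 0" "\<And>w. w \<noteq> 0 \<Longrightarrow> cmod w < d \<Longrightarrow> h w \<noteq> 0"
    by (auto simp: eventually_at dist_norm)
  have "h w \<noteq> 0" if "cmod w < d" for w
    using d(2)[of w] h0 v0 that by (cases "w = 0") auto
  then have "chain_sum v w \<noteq> 0" if "cmod w < d" for w
    using that by (fastforce simp: h_def)
  then show thesis using that[of "min d (1 / C)"] d v by simp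
qed

text \<open>A nonzero coefficient of positive index would make 0 an isolated zero of the sum, which
  is identically zero; index 0 is settled by evaluating at 0.\<close>

lemma powser_sums_0_imp_coeff_0:
  fixes a :: "nat \<Rightarrow> complex"
  assumes "r > 0" and a: "\<And>w. cmod w < r \<Longrightarrow> (\<lambda>k. a k * w ^ k) sums 0"
  shows "a k = 0"
proof (rule ccontr)
  assume "a k \<noteq> 0"
  moreover have "a 0 = 0" using a[of 0] \<open>r > 0\<close> by simp
  ultimately have "k > 0" by (cases k) auto
  show False
  proof (rule powser_0_nonzero[of r 0 a "\<lambda>_. 0" k])
    show False if "0 < s" "\<And>z::complex. z \<in> cball 0 s - {0} \<Longrightarrow> (0::complex) \<noteq> 0" for s
      using that(2)[of "of_real s"] that(1) by simp
  qed (use a \<open>r > 0\<close> \<open>a k \<noteq> 0\<close> \<open>k > 0\<close> in auto)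
qed

section \<open>Operators in the Cowen--Douglas class\<close>

text \<open>The generating series of a chain at \<open>z1\<close> is an eigenvector of
  \<open>T\<close> for \<open>z\<close>, nonzero near \<open>z1\<close>; as eigenspaces over
  \<Omega> are one-dimensional, it spans them.\<close>

lemma cowen_douglas_local_section:
  fixes T :: "'a::chilbert_space \<Rightarrow> 'a"
  assumes T: "T \<in> cowen_douglas_1 \<Omega>" and "open \<Omega>" "z1 \<in> \<Omega>"
    and chain: "op_minus T z1 (v 0) = 0" "\<And>k. op_minus T z1 (v (Suc k)) = v k" "v 0 \<noteq> 0"
    and bound: "\<And>k. norm (v k) \<le> D * C ^ k" "C > 0"
  obtains r where "r > 0" "r \<le> 1 / C" "ball z1 r \<subseteq> \<Omega>"
    "\<And>z. z \<in> ball z1 r \<Longrightarrow> ker (op_minus T z) = range (\<lambda>c. c *\<^sub>C chain_sum v (z - z1))"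
proof -
  have bT: "bounded_clinear T" using T by (simp add: cowen_douglas_1_def)
  obtain r1 where r1: "r1 > 0" "r1 \<le> 1 / C" "\<And>w. cmod w < r1 \<Longrightarrow> chain_sum v w \<noteq> 0"
    using chain_sum_nonzero[of v D C] bound chain(3) by blast
  obtain r2 where r2: "r2 > 0" "ball z1 r2 \<subseteq> \<Omega>"
    using \<open>open \<Omega>\<close> \<open>z1 \<in> \<Omega>\<close> openE by blast
  show thesis
  proof (rule that[of "min r1 r2"])
    fix z assume "z \<in> ball z1 (min r1 r2)"
    then have z: "z \<in> \<Omega>" "cmod (z - z1) < r1"
      using r2 by (auto simp: dist_norm norm_minus_commute)
    have "op_minus T z1 (chain_sum v (z - z1)) = (z - z1) *\<^sub>C chain_sum v (z - z1)"
      using apply_chain_sum[of "op_minus T z1" v D C "z - z1"] bounded_clinear_op_minus[OF bT]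
        chain bound z r1 by simp
    then have "chain_sum v (z - z1) \<in> ker (op_minus (op_minus T z1) (z - z1))"
      by (simp add: in_ker_op_minus_iff)
    then have "chain_sum v (z - z1) \<in> ker (op_minus T z)"
      by (simp add: op_minus_op_minus)
    then show "ker (op_minus T z) = range (\<lambda>c. c *\<^sub>C chain_sum v (z - z1))"
      using T z r1(3) bT
      by (intro dim_1_eq_range_scaleC subspace_ker bounded_clinear_op_minus)
        (auto simp: cowen_douglas_1_def)
  qed (use r1 r2 in auto)
qed

text \<open>
  Lifting a kernel vector repeatedly through the open mapping theorem gives a chain, so no
  linear right inverse of \<open>T - z1\<close> is needed.
\<close>

lemma cowen_douglas_chain_exists:
  fixes T :: "'a::chilbert_space \<Rightarrow> 'a"
  assumes T: "T \<in> cowen_douglas_1 \<Omega>" and "z1 \<in> \<Omega>"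
  obtains v C D where "op_minus T z1 (v 0) = 0" "\<And>k. op_minus T z1 (v (Suc k)) = v k" "v 0 \<noteq> 0"
    "\<And>k. norm (v k) \<le> D * C ^ k" "C > 0"
proof -
  let ?A = "op_minus T z1"
  have "bounded_linear ?A" "surj ?A" and dim: "complex_vector.dim (ker ?A) = 1"
    using assms bounded_clinear_imp_linear[OF bounded_clinear_op_minus]
    by (auto simp: cowen_douglas_1_def)
  then obtain C where C: "C > 0" "\<And>y. \<exists>x. ?A x = y \<and> norm x \<le> C * norm y"
    using surj_bounded_preimage by blast
  then obtain L where L: "\<And>y. ?A (L y) = y" "\<And>y. norm (L y) \<le> C * norm y" by metis
  obtain e where e: "e \<in> ker ?A" "e \<noteq> 0" using dim_1_obtains_nonzero[OF dim] by blast
  show thesis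
  proof (rule that[of "\<lambda>k. (L ^^ k) e" "norm e" C])
    show "norm ((L ^^ k) e) \<le> norm e * C ^ k" for k
      using norm_funpow_le[of C L] L(2) C by simp
  qed (use e L C in \<open>auto simp: ker_def\<close>)
qed

lemma holomorphic_on_cinner_chain_sum:
  fixes v :: "nat \<Rightarrow> 'a::chilbert_space"
  assumes "\<And>k. norm (v k) \<le> D * C ^ k" "C > 0" "r \<le> 1 / C"
  shows "(\<lambda>z. cinner (chain_sum v (z - z1)) y) holomorphic_on ball z1 r"
proof (rule power_series_holomorphic)
  fix z assume "z \<in> ball z1 r"
  then have "cmod (z - z1) < 1 / C" using assms by (simp add: dist_norm norm_minus_commute)
  then show "(\<lambda>k. cinner (v k) y * (z - z1) ^ k) sums cinner (chain_sum v (z - z1)) y"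
    using assms by (intro cinner_chain_sum_sums)
qed

text \<open>Orthogonality of \<open>y\<close> to eigenspaces spreads from one disc to all of
  \<Omega>: locally it is the vanishing of one holomorphic function, and \<Omega> is connected.
  Density of the eigenvectors finishes the argument.\<close>

lemma cowen_douglas_orthogonal_eq_0:
  fixes T :: "'a::chilbert_space \<Rightarrow> 'a"
  assumes T: "T \<in> cowen_douglas_1 \<Omega>" and \<Omega>: "open \<Omega>" "connected \<Omega>" and "z0 \<in> \<Omega>"
    and "r0 > 0" "\<And>z x. z \<in> ball z0 r0 \<Longrightarrow> x \<in> ker (op_minus T z) \<Longrightarrow> cinner x y = 0"
  shows "y = 0"
proof -
  define P where "P z \<longleftrightarrow> (\<forall>x\<in>ker (op_minus T z). cinner x y = 0)" for z
  define U where "U = interior {z. P z}"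
  \<comment> \<open>Taking \<open>U\<close> open is essential: meeting \<open>U\<close> then
    supplies a nonempty open set of zeros, from which the identity theorem fills the whole
    disc.\<close>
  have dichotomy: "\<exists>r>0. ball z1 r \<inter> U = {} \<or> ball z1 r \<subseteq> U" if z1: "z1 \<in> \<Omega>" for z1
  proof -
    obtain v C D where v: "op_minus T z1 (v 0) = 0" "\<And>k. op_minus T z1 (v (Suc k)) = v k"
        "v 0 \<noteq> 0" "\<And>k. norm (v k) \<le> D * C ^ k" "C > 0"
      by (rule cowen_douglas_chain_exists[OF T z1]) (rule that)
    obtain r where r: "r > 0" "r \<le> 1 / C" "ball z1 r \<subseteq> \<Omega>"
      "\<And>z. z \<in> ball z1 r \<Longrightarrow> ker (op_minus T z) = range (\<lambda>c. c *\<^sub>C chain_sum v (z - z1))"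
      by (rule cowen_douglas_local_section[OF T \<Omega>(1) z1 v]) (rule that)
    have P_iff: "P z \<longleftrightarrow> cinner (chain_sum v (z - z1)) y = 0" if "z \<in> ball z1 r" for z
      using cinner_scaleC_left[of 1 "chain_sum v (z - z1)" y]
      unfolding P_def r(4)[OF that] by (auto simp: cinner_scaleC_left)
    have "ball z1 r \<subseteq> U" if ne: "ball z1 r \<inter> U \<noteq> {}"
    proof -
      have "P z" if "z \<in> ball z1 r" for z
      proof -
        have "cinner (chain_sum v (z - z1)) y = 0"
        proof (rule analytic_continuation_open[where s = "ball z1 r \<inter> U" and s' = "ball z1 r"
              and f = "\<lambda>z. cinner (chain_sum v (z - z1)) y" and g = "\<lambda>_. 0"])
          show "(\<lambda>z. cinner (chain_sum v (z - z1)) y) holomorphic_on ball z1 r"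
            by (rule holomorphic_on_cinner_chain_sum[OF v(4,5) r(2)])
          show "cinner (chain_sum v (z - z1)) y = 0" if "z \<in> ball z1 r \<inter> U" for z
            using that P_iff interior_subset[of "{z. P z}"] by (auto simp: U_def)
        qed (use ne that in \<open>auto simp: U_def\<close>)
        then show ?thesis using P_iff that by blast
      qed
      then show ?thesis unfolding U_def by (intro interior_maximal) auto
    qed
    then show ?thesis using r(1) by blast
  qed
  \<comment> \<open>\<open>V\<close> is the exterior of \<open>U\<close>. By the dichotomy no point
    of \<Omega> lies on the boundary of \<open>U\<close>, so these two disjoint open sets cover
    \<Omega>.\<close>
  define V where "V = {z. \<exists>r>0. ball z r \<inter> U = {}}"
  have "open V"
  proof (rule openI)
    fix z assume "z \<in> V"
    then obtain r where r: "r > 0" "ball z r \<inter> U = {}" by (auto simp: V_def)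
    have "ball z r \<subseteq> V"
    proof
      fix w assume "w \<in> ball z r"
      then obtain s where "s > 0" "ball w s \<subseteq> ball z r" using openE[OF open_ball] by blast
      then show "w \<in> V" using r unfolding V_def by blast
    qed
    then show "\<exists>e>0. ball z e \<subseteq> V" using r by blast
  qed
  moreover have "open U" by (simp add: U_def)
  moreover have "\<Omega> \<subseteq> U \<union> V"
  proof
    fix z assume "z \<in> \<Omega>"
    then obtain r where "r > 0" "ball z r \<inter> U = {} \<or> ball z r \<subseteq> U" using dichotomy by blast
    then show "z \<in> U \<union> V" unfolding V_def by (auto simp: subset_iff)
  qed
  moreover have "U \<inter> V \<inter> \<Omega> = {}"
    unfolding V_def using centre_in_ball by blast
  moreover have "z0 \<in> U"
    unfolding U_def mem_interior P_def using assms(5,6) by blast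
  ultimately have "V \<inter> \<Omega> = {}" using connectedD[OF \<Omega>(2), of U V] \<open>z0 \<in> \<Omega>\<close> by blast
  then have "\<Omega> \<subseteq> U" using \<open>\<Omega> \<subseteq> U \<union> V\<close> by blast
  then have "\<Omega> \<subseteq> {z. P z}" unfolding U_def using interior_subset by blast
  then have "\<forall>x\<in>(\<Union>z\<in>\<Omega>. ker (op_minus T z)). cinner x y = 0" by (auto simp: P_def)
  moreover have "closed_cspan (\<Union>z\<in>\<Omega>. ker (op_minus T z)) = UNIV"
    using T by (simp add: cowen_douglas_1_def)
  ultimately show "y = 0" unfolding closed_cspan_eq_UNIV_iff by blast
qed

text \<open>Orthogonality to the chain kills every coefficient of the paired series, hence
  \<open>y\<close> is orthogonal to all eigenspaces near \<open>z0\<close>. This serves both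
  \<open>T\<close> with right inverse \<open>B\<close> and the adjoint of \<open>B\<close> with the
  adjoint of \<open>T - z0\<close>.\<close>

lemma cowen_douglas_chain_complete:
  fixes T :: "'a::chilbert_space \<Rightarrow> 'a"
  assumes T: "T \<in> cowen_douglas_1 \<Omega>" "open \<Omega>" "connected \<Omega>" "z0 \<in> \<Omega>"
    and R: "bounded_linear R" "\<And>x. op_minus T z0 (R x) = x"
    and e: "op_minus T z0 e = 0" "e \<noteq> 0"
    and y: "\<And>k. cinner ((R ^^ k) e) y = 0"
  shows "y = 0"
proof -
  obtain C where C: "C > 0" "\<And>x. norm (R x) \<le> norm x * C"
    using bounded_linear.pos_bounded[OF R(1)] by blast
  let ?v = "\<lambda>k. (R ^^ k) e"
  have bound: "norm (?v k) \<le> norm e * C ^ k" for k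
    using norm_funpow_le[of C R] C by (simp add: mult.commute)
  have chain: "op_minus T z0 (?v 0) = 0" "op_minus T z0 (?v (Suc k)) = ?v k" "?v 0 \<noteq> 0" for k
    using e R(2) by simp_all
  obtain r where r: "r > 0" "r \<le> 1 / C" "ball z0 r \<subseteq> \<Omega>"
    "\<And>z. z \<in> ball z0 r \<Longrightarrow> ker (op_minus T z) = range (\<lambda>c. c *\<^sub>C chain_sum ?v (z - z0))"
    by (rule cowen_douglas_local_section[where v = ?v, OF T(1,2,4) chain bound C(1)]) (rule that)
  show "y = 0"
  proof (rule cowen_douglas_orthogonal_eq_0[OF T r(1)])
    fix z x assume z: "z \<in> ball z0 r" and "x \<in> ker (op_minus T z)"
    then obtain c where x: "x = c *\<^sub>C chain_sum ?v (z - z0)" using r(4) by blast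
    have "cmod (z - z0) < 1 / C" using z r by (simp add: dist_norm norm_minus_commute)
    from cinner_chain_sum_sums[OF bound C(1) this, of y]
    have "(\<lambda>k. 0) sums cinner (chain_sum ?v (z - z0)) y" by (simp only: y mult_zero_left)
    then have "cinner (chain_sum ?v (z - z0)) y = 0" by (rule sums_unique2[OF _ sums_zero])
    then show "cinner x y = 0" by (simp add: x cinner_scaleC_left)
  qed
qed

text \<open>A converse to completeness of chains: on a small disc the generating series started at
  \<open>e\<close> spans the kernel of \<open>S - w\<close>, and the one started at
  \<open>R u\<close> solves \<open>(S - w) x = u\<close>.\<close>

lemma cowen_douglas_ball:
  fixes S R :: "'a::chilbert_space \<Rightarrow> 'a"
  assumes S: "bounded_clinear S" and R: "bounded_clinear R" "\<And>x. S (R x) = x"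
    and ker: "ker S = range (\<lambda>c. c *\<^sub>C e)" "e \<noteq> 0"
    and complete: "\<And>y. (\<And>k. cinner ((R ^^ k) e) y = 0) \<Longrightarrow> y = 0"
  obtains \<epsilon> where "\<epsilon> > 0" "S \<in> cowen_douglas_1 (ball 0 \<epsilon>)"
proof -
  obtain C where C: "C > 0" "\<And>x. norm (R x) \<le> norm x * C"
    using bounded_linear.pos_bounded[OF bounded_clinear_imp_linear[OF R(1)]] by blast
  let ?s = "\<lambda>u. chain_sum (\<lambda>k. (R ^^ k) u)"
  have bound: "norm ((R ^^ k) u) \<le> norm u * C ^ k" for k u
    using norm_funpow_le[of C R] C by (simp add: mult.commute)
  have s: "S (?s u w) = S u + w *\<^sub>C ?s u w" if "cmod w < 1 / C" for u w
    using apply_chain_sum[OF S, of "\<lambda>k. (R ^^ k) u", OF _ bound C(1) that] R(2) by simp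
  have "S (1 *\<^sub>C e) = 0" using ker(1) unfolding ker_def by blast
  then have e: "S e = 0" by (simp add: scaleC_one)
  obtain r where r: "r > 0" "r \<le> 1 / C" "\<And>w. cmod w < r \<Longrightarrow> ?s e w \<noteq> 0"
    using chain_sum_nonzero[OF bound[of _ e] C(1)] ker(2) by auto
  have eig: "?s e w \<in> ker (op_minus S w)" if "cmod w < r" for w
    using s[of w e] e that r by (simp add: in_ker_op_minus_iff)
  \<comment> \<open>Since \<open>cmod w * C < 1\<close>, the map \<open>w *\<^sub>C R x\<close>
    shrinks every nonzero norm, so its only fixed point is 0.\<close>
  have unique: "x = 0" if "x = w *\<^sub>C R x" "cmod w < r" for x w
  proof (rule ccontr)
    assume "x \<noteq> 0"
    have "norm x = cmod w * norm (R x)" by (subst that(1)) (simp add: norm_scaleC)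
    also have "\<dots> \<le> cmod w * (norm x * C)" by (intro mult_left_mono C) simp
    also have "\<dots> < 1 / C * (norm x * C)"
      using that r C \<open>x \<noteq> 0\<close> by (intro mult_strict_right_mono) auto
    finally show False using C by simp
  qed
  have kernel: "ker (op_minus S w) = range (\<lambda>c. c *\<^sub>C ?s e w)" if w: "cmod w < r" for w
  proof
    \<comment> \<open>Subtracting \<open>w *\<^sub>C R x\<close> sends the kernel of
      \<open>S - w\<close> into the line \<open>ker S\<close>, injectively by \<open>unique\<close>;
      hence that kernel has dimension at most one.\<close>
    have decomp: "\<exists>c. x - w *\<^sub>C R x = c *\<^sub>C e" if "x \<in> ker (op_minus S w)" for x
    proof -
      have "S (x - w *\<^sub>C R x) = 0"
        using that by (simp add: in_ker_op_minus_iff bounded_clinear_diff[OF S]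
            bounded_clinear_scaleC[OF S] R(2))
      then show ?thesis using ker(1) unfolding ker_def by blast
    qed
    obtain c' where c': "?s e w - w *\<^sub>C R (?s e w) = c' *\<^sub>C e" using decomp eig[OF w] by blast
    have "c' \<noteq> 0" using unique[OF _ w, of "?s e w"] r(3)[OF w] c' by auto
    show "ker (op_minus S w) \<subseteq> range (\<lambda>c. c *\<^sub>C ?s e w)"
    proof
      fix x assume "x \<in> ker (op_minus S w)"
      then obtain c where c: "x - w *\<^sub>C R x = c *\<^sub>C e" using decomp by blast
      define d where "d = x - (c / c') *\<^sub>C ?s e w"
      have "d - w *\<^sub>C R d = (x - w *\<^sub>C R x) - (c / c') *\<^sub>C (?s e w - w *\<^sub>C R (?s e w))"
        by (simp add: d_def bounded_clinear_diff[OF R(1)] bounded_clinear_scaleC[OF R(1)]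
            complex_vector.scale_right_diff_distrib scaleC_scaleC mult.commute)
      also have "\<dots> = 0" using \<open>c' \<noteq> 0\<close> by (simp add: c c' scaleC_scaleC)
      finally have "d = 0" using unique[OF _ w, of d] by simp
      then have "x = (c / c') *\<^sub>C ?s e w" by (simp add: d_def)
      then show "x \<in> range (\<lambda>c. c *\<^sub>C ?s e w)" by (rule range_eqI)
    qed
    show "range (\<lambda>c. c *\<^sub>C ?s e w) \<subseteq> ker (op_minus S w)"
      using eig[OF w] subspace_ker[OF bounded_clinear_op_minus[OF S]]
      by (auto intro: complex_vector.subspace_scale)
  qed
  have "S \<in> cowen_douglas_1 (ball 0 r)"
    unfolding cowen_douglas_1_def
  proof (intro CollectI conjI ballI S subsetI)
    fix w :: complex assume "w \<in> ball 0 r"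
    then have w: "cmod w < r" by simp
    show "w \<in> spectrum S"
      by (rule in_spectrum_if_eigenvector[of _ "?s e w"])
        (use eig[OF w] r(3)[OF w] in \<open>auto simp: in_ker_op_minus_iff\<close>)
    show "complex_vector.dim (ker (op_minus S w)) = 1"
      unfolding kernel[OF w] by (rule dim_range_scaleC[OF r(3)[OF w]])
    \<comment> \<open>Here the initial term of the series is mapped by \<open>S\<close> to
      \<open>u\<close> instead of 0.\<close>
    have "op_minus S w (?s (R u) w) = u" for u
      using s[of w "R u"] w r by (simp add: op_minus_def R(2))
    then show "range (op_minus S w) = UNIV" by (rule surjI)
  next
    show "closed_cspan (\<Union>w\<in>ball 0 r. ker (op_minus S w)) = UNIV"
      unfolding closed_cspan_eq_UNIV_iff
    proof (intro allI impI)
      fix y assume y: "\<forall>x\<in>(\<Union>w\<in>ball 0 r. ker (op_minus S w)). cinner x y = 0"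
      have sums_0: "(\<lambda>k. cinner ((R ^^ k) e) y * w ^ k) sums 0" if "cmod w < r" for w
      proof -
        have "cinner (?s e w) y = 0" using y eig[OF that] that by auto
        then show ?thesis
          using cinner_chain_sum_sums[OF bound[of _ e] C(1), of w y] that r(2) by simp
      qed
      show "y = 0"
        by (rule complete)
          (rule powser_sums_0_imp_coeff_0[where a = "\<lambda>k. cinner ((R ^^ k) e) y", OF r(1) sums_0])
    qed
  qed
  with r(1) show thesis using that by blast
qed

section \<open>The equivalences\<close>

lemma funpow_right_inverse:
  fixes S R :: "'a \<Rightarrow> 'a"
  assumes "\<And>x. S (R x) = x"
  shows "(S ^^ k) ((R ^^ k) x) = x"
proof (induction k arbitrary: x)
  case (Suc k)
  have "(S ^^ Suc k) ((R ^^ Suc k) x) = (S ^^ k) (S (R ((R ^^ k) x)))"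
    by (simp add: funpow_swap1)
  then show ?case using Suc by (simp add: assms)
qed simp

lemma bounded_clinear_funpow:
  assumes "bounded_clinear S"
  shows "bounded_clinear (S ^^ k)"
proof (induction k)
  case 0
  then show ?case by (simp add: bounded_clinear_def bounded_linear_ident id_def)
next
  case (Suc k)
  with assms show ?case
    using bounded_linear_compose[of S "S ^^ k"] by (simp add: bounded_clinear_def o_def)
qed

text \<open>Each further power of \<open>S\<close> enlarges the kernel by one direction:
  \<open>(S ^^ k) x\<close> is a multiple of \<open>e\<close> when \<open>x\<close> lies in the
  kernel of the next power, and subtracting that multiple of \<open>(R ^^ k) e\<close> drops
  \<open>x\<close> into \<open>ker (S ^^ k)\<close>.\<close>

lemma orthogonal_ker_funpow_iff:
  fixes S R :: "'a::chilbert_space \<Rightarrow> 'a"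
  assumes S: "bounded_clinear S" and SR: "\<And>x. S (R x) = x"
    and ker: "ker S = range (\<lambda>c. c *\<^sub>C e)"
  shows "(\<forall>x\<in>(\<Union>k. ker (S ^^ k)). cinner x y = 0) \<longleftrightarrow> (\<forall>k. cinner ((R ^^ k) e) y = 0)"
proof (intro iffI allI)
  fix k
  assume y: "\<forall>x\<in>(\<Union>k. ker (S ^^ k)). cinner x y = 0"
  have "1 *\<^sub>C e \<in> ker S" unfolding ker by blast
  then have "S e = 0" by (simp add: ker_def scaleC_one)
  then have "(R ^^ k) e \<in> ker (S ^^ Suc k)"
    by (simp add: ker_def funpow_right_inverse[of S R, OF SR])
  with y show "cinner ((R ^^ k) e) y = 0" by blast
next
  assume y: "\<forall>k. cinner ((R ^^ k) e) y = 0"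
  have "cinner x y = 0" if "x \<in> ker (S ^^ k)" for x k
    using that
  proof (induction k arbitrary: x)
    case 0
    then show ?case by (simp add: ker_def)
  next
    case (Suc k)
    then have "(S ^^ k) x \<in> ker S" by (simp add: ker_def)
    then obtain c where c: "(S ^^ k) x = c *\<^sub>C e" using ker by blast
    have "(S ^^ k) (x - c *\<^sub>C (R ^^ k) e) = 0"
      using bounded_clinear_funpow[OF S, of k]
      by (simp add: bounded_clinear_diff bounded_clinear_scaleC c
          funpow_right_inverse[of S R, OF SR])
    then have "cinner (x - c *\<^sub>C (R ^^ k) e) y = 0" by (intro Suc.IH) (simp add: ker_def)
    with y show ?case by (simp add: cinner_diff_left cinner_scaleC_left)
  qed
  then show "\<forall>x\<in>(\<Union>k. ker (S ^^ k)). cinner x y = 0" by blast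
qed

theorem theorem4p1:
  fixes T B :: "'a::chilbert_space \<Rightarrow> 'a"
    and \<Omega> :: "complex set" and z0 :: complex
  assumes "separable_space (euclidean :: 'a topology)"
    and "infinite_dimensional TYPE('a)"
    and "open \<Omega>" and "connected \<Omega>"
    and "T \<in> cowen_douglas_1 \<Omega>"
    and "z0 \<in> \<Omega>"
    and "canonical_right_inverse (op_minus T z0) B"
  shows "(closed_cspan (\<Union>k. ker (cadjoint B ^^ k)) = UNIV \<longleftrightarrow>
          (\<exists>f. markushevich_basis f \<and> (\<forall>k\<ge>1. cinner (f 0) (f k) = 0) \<and>
               backward_shift_on (op_minus T z0) f)) \<and>
         ((\<exists>f. markushevich_basis f \<and> (\<forall>k\<ge>1. cinner (f 0) (f k) = 0) \<and>
               backward_shift_on (op_minus T z0) f) \<longleftrightarrow>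
          (\<exists>\<epsilon>::real. \<epsilon> > 0 \<and> cadjoint B \<in> cowen_douglas_1 (ball 0 \<epsilon>)))"
proof -

  \<comment> \<open>The two biorthogonal chains\<close>
  define A where "A = op_minus T z0"
  define S where "S = cadjoint B"
  define R where "R = cadjoint A"
  have A: "bounded_clinear A" and dimA: "complex_vector.dim (ker A) = 1"
    using assms(5,6) by (auto simp: A_def cowen_douglas_1_def bounded_clinear_op_minus)
  have B: "bounded_clinear B" "\<And>x. A (B x) = x" "range B = orth_compl (ker A)"
    using assms(7) by (auto simp: canonical_right_inverse_def A_def fun_eq_iff)
  have S: "bounded_clinear S" "\<And>x y. cinner (B x) y = cinner x (S y)"
    unfolding S_def by (rule cadjoint[OF B(1)])+
  have R: "bounded_clinear R" "\<And>x y. cinner (A x) y = cinner x (R y)"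
    unfolding R_def by (rule cadjoint[OF A])+
  \<comment> \<open>This is the adjoint of the identity \<open>A (B x) = x\<close>.\<close>
  have SR: "S (R x) = x" for x
    by (rule cinner_eqI) (simp add: B(2) flip: S(2) R(2))
  obtain e where e: "norm e = 1" "A e = 0" and kerA: "ker A = range (\<lambda>c. c *\<^sub>C e)"
  proof -
    obtain a where a: "a \<in> ker A" "a \<noteq> 0" using dim_1_obtains_nonzero[OF dimA] by blast
    define u where "u = complex_of_real (1 / norm a) *\<^sub>C a"
    have "norm u = 1" using a by (simp add: u_def norm_scaleC norm_divide)
    moreover have "u \<in> ker A"
      unfolding u_def by (rule complex_vector.subspace_scale[OF subspace_ker[OF A] a(1)])
    moreover have "u \<noteq> 0" using \<open>norm u = 1\<close> by auto
    ultimately show thesis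
      using that[of u] dim_1_eq_range_scaleC[OF subspace_ker[OF A] dimA, of u]
      by (auto simp: ker_def)
  qed
  have e0: "e \<noteq> 0" "cinner e e = 1" using e(1) by (auto simp: cinner_self)
  have range_B: "x \<in> range B \<longleftrightarrow> cinner x e = 0" for x
    unfolding B(3) orth_compl_def kerA
    by (auto simp: cinner_scaleC_right dest: spec[of _ 1])
  have Be: "cinner (B x) e = 0" for x using range_B by blast
  have Se: "S e = 0" by (rule cinner_eqI) (simp add: Be flip: S(2))
  have kerS: "ker S = range (\<lambda>c. c *\<^sub>C e)"
  proof
    show "ker S \<subseteq> range (\<lambda>c. c *\<^sub>C e)"
    proof
      fix x assume x: "x \<in> ker S"
      \<comment> \<open>The component of \<open>x\<close> orthogonal to \<open>e\<close> lies in
        \<open>range B\<close>, while \<open>S x' = 0\<close> makes it orthogonal to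
        \<open>range B\<close>; so it is orthogonal to itself.\<close>
      define x' where "x' = x - cinner x e *\<^sub>C e"
      have "cinner x' e = 0" by (simp add: x'_def cinner_diff_left cinner_scaleC_left e0)
      then obtain u where u: "x' = B u" using range_B by blast
      have "S x' = 0"
        using x by (simp add: x'_def ker_def bounded_clinear_diff[OF S(1)]
            bounded_clinear_scaleC[OF S(1)] Se)
      then have "cinner (B u) x' = 0" by (simp add: S(2))
      then have "x = cinner x e *\<^sub>C e" using u by (simp add: x'_def)
      then show "x \<in> range (\<lambda>c. c *\<^sub>C e)" by (rule range_eqI)
    qed
    show "range (\<lambda>c. c *\<^sub>C e) \<subseteq> ker S"
      by (auto simp: ker_def bounded_clinear_scaleC[OF S(1)] Se)
  qed
  have complete: "y = 0" if "\<And>k. cinner ((B ^^ k) e) y = 0" for y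
    using cowen_douglas_chain_complete[OF assms(5,3,4,6) bounded_clinear_imp_linear[OF B(1)],
        folded A_def, OF B(2) e(2) e0(1) that] .
  \<comment> \<open>Moving one \<open>R\<close> across as \<open>A\<close> cancels one
    \<open>B\<close>. The process ends with \<open>A e = 0\<close> or with \<open>range B\<close>
    orthogonal to \<open>e\<close>, unless the exponents agree.\<close>
  have biorth: "cinner ((B ^^ i) e) ((R ^^ j) e) = (if i = j then 1 else 0)" for i j
  proof (induction j arbitrary: i)
    case 0
    then show ?case by (cases i) (simp_all add: e0 Be)
  next
    case (Suc j)
    then show ?case by (cases i) (simp_all add: e(2) B(2) flip: R(2))
  qed

  \<comment> \<open>Comparison of the three conditions with completeness of the dual chain\<close>
  define total where "total \<longleftrightarrow> (\<forall>y. (\<forall>k. cinner ((R ^^ k) e) y = 0) \<longrightarrow> y = 0)"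
  have iff1: "closed_cspan (\<Union>k. ker (S ^^ k)) = UNIV \<longleftrightarrow> total"
    unfolding closed_cspan_eq_UNIV_iff orthogonal_ker_funpow_iff[of S R, OF S(1) SR kerS] total_def ..
  have iff2: "(\<exists>f. markushevich_basis f \<and> (\<forall>k\<ge>1. cinner (f 0) (f k) = 0) \<and>
      backward_shift_on A f) \<longleftrightarrow> total"
  proof
    assume total
    let ?f = "\<lambda>k. (B ^^ k) e"
    have "closed_cspan (range ?f) = UNIV"
      unfolding closed_cspan_eq_UNIV_iff using complete by blast
    moreover have "{x. \<forall>k. cinner x ((R ^^ k) e) = 0} = {0}"
      using \<open>total\<close> by (auto simp: total_def cinner_eq_0_commute[of _ "(R ^^ _) e"])
    ultimately have "markushevich_basis ?f"
      unfolding markushevich_basis_def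
      by (intro conjI exI[of _ "\<lambda>j. (R ^^ j) e"] allI biorth)
    moreover have "\<forall>k\<ge>1. cinner (?f 0) (?f k) = 0"
    proof (intro allI impI)
      fix k :: nat assume "k \<ge> 1"
      then have "cinner (?f k) e = 0" by (cases k) (simp_all add: Be)
      then show "cinner (?f 0) (?f k) = 0" by (simp add: cinner_eq_0_commute[of e])
    qed
    moreover have "backward_shift_on A ?f" by (simp add: backward_shift_on_def e(2) B(2))
    ultimately show "\<exists>f. markushevich_basis f \<and> (\<forall>k\<ge>1. cinner (f 0) (f k) = 0) \<and>
      backward_shift_on A f" by blast
  next
    assume "\<exists>f. markushevich_basis f \<and> (\<forall>k\<ge>1. cinner (f 0) (f k) = 0) \<and>
      backward_shift_on A f"
    then obtain f where mb: "markushevich_basis f"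
      and f0: "\<And>k. k \<ge> 1 \<Longrightarrow> cinner (f 0) (f k) = 0" and "backward_shift_on A f"
      by blast
    then have shift: "A (f 0) = 0" "A (f (Suc k)) = f k" for k
      by (simp_all add: backward_shift_on_def)
    obtain g where "\<forall>i j. cinner (f i) (g j) = (if i = j then 1 else 0)"
      and g: "{x. \<forall>k. cinner x (g k) = 0} = {0}"
      using mb unfolding markushevich_basis_def by (elim conjE exE)
    then have fg: "cinner (f i) (g j) = (if i = j then 1 else 0)" for i j by simp
    obtain c where c: "f 0 = c *\<^sub>C e" using shift(1) kerA unfolding ker_def by blast
    have "f 0 \<noteq> 0" using fg[of 0 0] by auto
    then have "c \<noteq> 0" using c by auto
    \<comment> \<open>Orthogonality to \<open>f 0\<close> places \<open>f (Suc k)\<close> in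
      \<open>range B\<close>, where \<open>B\<close> undoes \<open>A\<close>; this is where the
      condition on \<open>f 0\<close> enters.\<close>
    have fS: "f (Suc k) = B (f k)" for k
    proof -
      have "cinner e (f (Suc k)) = 0"
        using f0[of "Suc k"] \<open>c \<noteq> 0\<close> by (simp add: c cinner_scaleC_left)
      then obtain u where "f (Suc k) = B u"
        using range_B cinner_eq_0_commute by blast
      then show ?thesis using shift(2)[of k] B(2) by metis
    qed
    have f: "f k = c *\<^sub>C (B ^^ k) e" for k
      by (induction k) (simp_all add: c fS bounded_clinear_scaleC[OF B(1)])
    \<comment> \<open>Both sides have the same pairings with all \<open>(B ^^ i) e\<close>, which
      are complete. The conjugate compensates for conjugate-linearity in the second
      argument.\<close>
    have gR: "g k = cnj (1 / c) *\<^sub>C (R ^^ k) e" for k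
    proof -
      have "cinner ((B ^^ i) e) (g k - cnj (1 / c) *\<^sub>C (R ^^ k) e) = 0" for i
        using fg[of i k] \<open>c \<noteq> 0\<close>
        by (auto simp: f cinner_diff_right cinner_scaleC_left cinner_scaleC_right biorth
            field_simps split: if_splits)
      then show ?thesis using complete by fastforce
    qed
    show total
      unfolding total_def
    proof (intro allI impI)
      fix y assume "\<forall>k. cinner ((R ^^ k) e) y = 0"
      then have "\<forall>k. cinner y (g k) = 0"
        by (simp add: gR cinner_scaleC_right cinner_eq_0_commute[of y])
      then show "y = 0" using g by blast
    qed
  qed
  have iff3: "(\<exists>\<epsilon>::real. \<epsilon> > 0 \<and> S \<in> cowen_douglas_1 (ball 0 \<epsilon>)) \<longleftrightarrow> total"
  proof
    assume "\<exists>\<epsilon>::real. \<epsilon> > 0 \<and> S \<in> cowen_douglas_1 (ball 0 \<epsilon>)"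
    then obtain \<epsilon> :: real where \<epsilon>: "\<epsilon> > 0" "S \<in> cowen_douglas_1 (ball 0 \<epsilon>)" by blast
    \<comment> \<open>The roles are exchanged: \<open>S\<close> replaces \<open>T\<close>, the
      centre is 0, and \<open>R\<close> is the right inverse generating the chain.\<close>
    have "y = 0" if "\<forall>k. cinner ((R ^^ k) e) y = 0" for y
      using cowen_douglas_chain_complete[OF \<epsilon>(2) open_ball connected_ball _
          bounded_clinear_imp_linear[OF R(1)], of 0 e y] \<epsilon>(1) SR Se e0(1) that
      by simp
    then show total unfolding total_def by blast
  next
    assume total
    then have "y = 0" if "\<And>k. cinner ((R ^^ k) e) y = 0" for y
      using that unfolding total_def by blast
    then show "\<exists>\<epsilon>::real. \<epsilon> > 0 \<and> S \<in> cowen_douglas_1 (ball 0 \<epsilon>)"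
      using cowen_douglas_ball[OF S(1) R(1) SR kerS e0(1)] by metis
  qed
  show ?thesis
    using iff1 iff2 iff3 unfolding A_def S_def by blast
qed

end
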